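(* For every graph $G$ without an induced copy of $C_4$, $$\max_{\sigma}\mathrm{fix}(G_\sigma)=\mathrm{mis}(G),$$ where the maximum is over all repartitions of signs $\sigma$ in $G$.
   Context: A graph means a finite loop-less symmetric digraph, i.e. each undirected edge $\{u,v\}$ of a finite simple graph is viewed as the two arcs $uv$ and $vu$; graph-theoretic notions (independent set, induced subgraph) refer to the undirected graph. $C_4$ is the undirected cycle of length 4. $\mathrm{mis}(G)$ is the number of (inclusion-)maximal independent sets of $G$. A repartition of signs $\sigma$ in $G$ assigns to each arc a sign, positive or negative (zero signs are not allowed); the arcs $uv$ and $vu$ may get different signs. $G_\sigma$ is $G$ together with $\sigma$. With $V$ the vertex set of $G$, the conjunctive network on $G_\sigma$ is the map $f:\{0,1\}^V\to\{0,1\}^V$ with $$f_v(x)=\prod_{u:\ uv\text{ is a positive arc}}x_u\ \prod_{u:\ uv\text{ is a negative arc}}(1-x_u)\qquad(v\in V),$$ an empty product being 1. $\mathrm{fix}(G_\sigma)$ is the number of $x\in\{0,1\}^V$ with $f(x)=x$. *)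

theory Defs
  imports
    "HOL-Library.FuncSet"
    "Graph_Theory.Pair_Digraph"
    "Graph_Theory.Digraph_Isomorphism"
begin

text \<open>
  Graphs are finite loop-less symmetric digraphs, that is, instances of the locale
  \<^locale>\<open>pair_graph\<close>. The empty graph is included. An arc from \<open>u\<close> to \<open>v\<close> is the pair \<open>(u, v)\<close>.
\<close>

definition C4 :: "nat pair_pre_digraph" where
  "C4 = \<lparr> pverts = {0, 1, 2, 3},
          parcs = {(0, 1), (1, 0), (1, 2), (2, 1), (2, 3), (3, 2), (3, 0), (0, 3)} \<rparr>"

definition has_induced_C4 :: "'a pair_pre_digraph \<Rightarrow> bool" where
  "has_induced_C4 G \<longleftrightarrow>
     (\<exists>H. induced_subgraph H (with_proj G) \<and> digraph_iso (with_proj C4) H)"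

definition independent_set :: "'a pair_pre_digraph \<Rightarrow> 'a set \<Rightarrow> bool" where
  "independent_set G S \<longleftrightarrow> S \<subseteq> pverts G \<and> (\<forall>u\<in>S. \<forall>v\<in>S. (u, v) \<notin> parcs G)"

definition maximal_independent_set :: "'a pair_pre_digraph \<Rightarrow> 'a set \<Rightarrow> bool" where
  "maximal_independent_set G S \<longleftrightarrow>
     independent_set G S \<and> (\<forall>T. independent_set G T \<and> S \<subseteq> T \<longrightarrow> T = S)"

definition mis :: "'a pair_pre_digraph \<Rightarrow> nat" where
  "mis G = card {S. maximal_independent_set G S}"

datatype sign = Positive | Negative

text \<open>
  Repartitions of signs and points of \<open>{0, 1}\<^sup>V\<close> are extensional functions, so that each one is
  represented exactly once.
\<close>

definition sign_repartitions :: "'a pair_pre_digraph \<Rightarrow> ('a \<times> 'a \<Rightarrow> sign) set" where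
  "sign_repartitions G = parcs G \<rightarrow>\<^sub>E {Positive, Negative}"

definition configurations :: "'a pair_pre_digraph \<Rightarrow> ('a \<Rightarrow> int) set" where
  "configurations G = pverts G \<rightarrow>\<^sub>E {0, 1}"

definition conjunctive_network ::
    "'a pair_pre_digraph \<Rightarrow> ('a \<times> 'a \<Rightarrow> sign) \<Rightarrow> ('a \<Rightarrow> int) \<Rightarrow> ('a \<Rightarrow> int)" where
  "conjunctive_network G \<sigma> x =
     (\<lambda>v\<in>pverts G.
        (\<Prod>u\<in>{u. (u, v) \<in> parcs G \<and> \<sigma> (u, v) = Positive}. x u) *
        (\<Prod>u\<in>{u. (u, v) \<in> parcs G \<and> \<sigma> (u, v) = Negative}. 1 - x u))"

definition num_fixed_points :: "'a pair_pre_digraph \<Rightarrow> ('a \<times> 'a \<Rightarrow> sign) \<Rightarrow> nat" where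
  "num_fixed_points G \<sigma> = card {x \<in> configurations G. conjunctive_network G \<sigma> x = x}"

lemma pair_graph_C4: "pair_graph C4"
  by unfold_locales (auto simp: C4_def symmetric_def sym_def)

lemma sign_repartitions_nonempty: "sign_repartitions G \<noteq> {}"
  by (simp add: sign_repartitions_def PiE_eq_empty_iff)

lemma (in pair_graph) finite_sign_repartitions: "finite (sign_repartitions G)"
  by (simp add: sign_repartitions_def finite_PiE pair_finite_arcs)

lemma (in pair_graph) finite_configurations: "finite (configurations G)"
  by (simp add: configurations_def finite_PiE pair_finite_verts)

lemma (in pair_graph) finite_maximal_independent_sets:
  "finite {S. maximal_independent_set G S}"
  by (rule finite_subset[of _ "Pow (pverts G)"])
     (auto simp: maximal_independent_set_def independent_set_def pair_finite_verts)

lemma prod_in_01: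
  fixes g :: "'b \<Rightarrow> int"
  assumes "\<And>u. u \<in> A \<Longrightarrow> g u \<in> {0, 1}"
  shows "prod g A \<in> {0, 1}"
  using assms
proof (induction A rule: infinite_finite_induct)
  case (insert a A)
  have "g a \<in> {0, 1}" and "prod g A \<in> {0, 1}"
    using insert by blast+
  with insert.hyps show ?case by (auto simp: prod.insert)
qed simp_all

lemma (in pair_graph) conjunctive_network_in_configurations:
  assumes "x \<in> configurations G"
  shows "conjunctive_network G \<sigma> x \<in> configurations G"
proof -
  have x: "x u \<in> {0, 1}" if "(u, v) \<in> parcs G" for u v
    using assms in_arcsD1[OF that] unfolding configurations_def by (rule PiE_mem)
  have "(\<Prod>u\<in>{u. (u, v) \<in> parcs G \<and> \<sigma> (u, v) = Positive}. x u) *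
        (\<Prod>u\<in>{u. (u, v) \<in> parcs G \<and> \<sigma> (u, v) = Negative}. 1 - x u) \<in> {0, 1}" for v
  proof -
    have "(\<Prod>u\<in>{u. (u, v) \<in> parcs G \<and> \<sigma> (u, v) = Positive}. x u) \<in> {0, 1}"
      by (rule prod_in_01) (use x in blast)
    moreover have "(\<Prod>u\<in>{u. (u, v) \<in> parcs G \<and> \<sigma> (u, v) = Negative}. 1 - x u) \<in> {0, 1}"
      by (rule prod_in_01) (use x in fastforce)
    ultimately show ?thesis by auto
  qed
  then show ?thesis
    unfolding configurations_def conjunctive_network_def restrict_PiE_iff by blast
qed

end

theory Submission
  imports Defs
begin

text \<open>
  With all arcs negative the fixed points are exactly the maximal independent sets. For the upper
  bound, a fixed point (as a set of vertices) is constant on the components formed by the edges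
  that are positive in both directions. Keeping one such edge per component and releasing all other
  vertices gives a matching \<open>M\<close>, and every fixed point extends injectively to a set that is
  independent apart from \<open>M\<close>, saturates or avoids each edge of \<open>M\<close>, and dominates all vertices
  outside \<open>M\<close>. The edges of \<open>M\<close> are then released one at a time. Releasing \<open>uv\<close> does not decrease
  the number of such sets, because without an induced \<open>C\<^sub>4\<close> there is no edge between a vertex
  adjacent to \<open>u\<close> only and one adjacent to \<open>v\<close> only.
\<close>

text \<open>For a matching \<open>M\<close>, these sets correspond to the independent sets of the
  graph in which each edge of \<open>M\<close> is contracted to a point.\<close>

definition matched_independent :: "'a pair_pre_digraph \<Rightarrow> ('a \<times> 'a) set \<Rightarrow> 'a set \<Rightarrow> bool" where
  "matched_independent G M T \<longleftrightarrow>
     T \<subseteq> pverts G \<and> (\<forall>a b. (a, b) \<in> M \<longrightarrow> a \<in> T \<longrightarrow> b \<in> T) \<and>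
     (\<forall>u\<in>T. \<forall>v\<in>T. (u, v) \<in> parcs G \<longrightarrow> (u, v) \<in> M)"

text \<open>Domination is asked only outside \<open>Domain M\<close>, so an edge of \<open>M\<close>
  may be avoided even if no neighbour of it is in the set. This mirrors fixed points: a component of
  mutually positive edges may be constantly 0 without any neighbour of value 1.\<close>

definition matched_maximal :: "'a pair_pre_digraph \<Rightarrow> ('a \<times> 'a) set \<Rightarrow> 'a set \<Rightarrow> bool" where
  "matched_maximal G M T \<longleftrightarrow>
     matched_independent G M T \<and>
     (\<forall>v\<in>pverts G. v \<notin> T \<longrightarrow> v \<notin> Domain M \<longrightarrow> (\<exists>u\<in>T. (u, v) \<in> parcs G))"

text \<open>Both arcs of each matching edge are stored, so \<open>M\<close> is the graph of a
  partial involution.\<close>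

definition matching :: "'a pair_pre_digraph \<Rightarrow> ('a \<times> 'a) set \<Rightarrow> bool" where
  "matching G M \<longleftrightarrow> M \<subseteq> parcs G \<and> sym M \<and> single_valued M"

definition fixed_set :: "'a pair_pre_digraph \<Rightarrow> ('a \<times> 'a \<Rightarrow> sign) \<Rightarrow> 'a set \<Rightarrow> bool" where
  "fixed_set G \<sigma> S \<longleftrightarrow>
     S \<subseteq> pverts G \<and>
     (\<forall>v\<in>pverts G. v \<in> S \<longleftrightarrow> (\<forall>u. (u, v) \<in> parcs G \<longrightarrow> (\<sigma> (u, v) = Positive \<longleftrightarrow> u \<in> S)))"

section \<open>Fixed points as vertex sets\<close>

lemma prod_of_bool:
  "finite A \<Longrightarrow> (\<Prod>u\<in>A. of_bool (P u)) = (of_bool (\<forall>u\<in>A. P u) :: int)"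
  by (induction A rule: finite_induct) auto

context pair_graph
begin

lemma arc_sym: "(u, v) \<in> parcs G \<longleftrightarrow> (v, u) \<in> parcs G"
  using pair_sym_arcs by (auto simp: symmetric_def dest: symD)

lemma arc_irrefl [simp]: "(u, u) \<notin> parcs G"
  using no_loops' by blast

lemma conjunctive_network_indicator:
  assumes v: "v \<in> pverts G"
  shows "conjunctive_network G \<sigma> (\<lambda>w\<in>pverts G. of_bool (w \<in> S)) v =
    of_bool (\<forall>u. (u, v) \<in> parcs G \<longrightarrow> (\<sigma> (u, v) = Positive \<longleftrightarrow> u \<in> S))"
proof -
  let ?P = "{u. (u, v) \<in> parcs G \<and> \<sigma> (u, v) = Positive}"
  let ?N = "{u. (u, v) \<in> parcs G \<and> \<sigma> (u, v) = Negative}"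
  let ?x = "\<lambda>w\<in>pverts G. of_bool (w \<in> S) :: int"
  have fin: "finite ?P" "finite ?N"
    by (rule finite_subset[OF _ pair_finite_verts], use in_arcsD1 in blast)+
  have "prod ?x ?P = (\<Prod>u\<in>?P. of_bool (u \<in> S))"
    by (rule prod.cong) (use in_arcsD1 in auto)
  moreover have "(\<Prod>u\<in>?N. 1 - ?x u) = (\<Prod>u\<in>?N. of_bool (u \<notin> S))"
    by (rule prod.cong) (use in_arcsD1 in auto)
  ultimately have "conjunctive_network G \<sigma> ?x v =
      of_bool (\<forall>u\<in>?P. u \<in> S) * of_bool (\<forall>u\<in>?N. u \<notin> S)"
    using v fin by (simp add: conjunctive_network_def prod_of_bool)
  also have "\<dots> = of_bool (\<forall>u. (u, v) \<in> parcs G \<longrightarrow> (\<sigma> (u, v) = Positive \<longleftrightarrow> u \<in> S))"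
  proof -
    have negative: "\<sigma> e = Negative \<longleftrightarrow> \<sigma> e \<noteq> Positive" for e
      by (cases "\<sigma> e") auto
    have "(\<forall>u\<in>?P. u \<in> S) \<and> (\<forall>u\<in>?N. u \<notin> S) \<longleftrightarrow>
        (\<forall>u. (u, v) \<in> parcs G \<longrightarrow> (\<sigma> (u, v) = Positive \<longleftrightarrow> u \<in> S))"
      unfolding negative by blast
    then show ?thesis by (simp only: of_bool_conj[symmetric])
  qed
  finally show ?thesis .
qed

text \<open>Taking the set of ones of a configuration and taking the indicator of a vertex set are
  mutually inverse, and they exchange fixed points with the sets satisfying
  \<open>fixed_set\<close>.\<close>

lemma num_fixed_points_eq: "num_fixed_points G \<sigma> = card {S. fixed_set G \<sigma> S}"
proof -
  define ind :: "'a set \<Rightarrow> 'a \<Rightarrow> int" where "ind S = (\<lambda>w\<in>pverts G. of_bool (w \<in> S))" for S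
  have ind_fixed: "conjunctive_network G \<sigma> (ind S) = ind S \<longleftrightarrow> fixed_set G \<sigma> S"
    if S: "S \<subseteq> pverts G" for S
  proof -
    have "conjunctive_network G \<sigma> (ind S) = ind S \<longleftrightarrow>
        (\<forall>v\<in>pverts G. conjunctive_network G \<sigma> (ind S) v = ind S v)"
      by (auto simp: fun_eq_iff conjunctive_network_def ind_def)
    also have "\<dots> \<longleftrightarrow> fixed_set G \<sigma> S"
      using S conjunctive_network_indicator[of _ \<sigma> S]
      by (auto simp: ind_def fixed_set_def of_bool_eq_iff)
    finally show ?thesis .
  qed
  have ind_ones: "ind {v \<in> pverts G. x v = 1} = x" if "x \<in> configurations G" for x
    using that unfolding configurations_def PiE_iff
    by (fastforce simp: ind_def fun_eq_iff extensional_def)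
  have "bij_betw ind {S. fixed_set G \<sigma> S}
      {x \<in> configurations G. conjunctive_network G \<sigma> x = x}"
  proof (rule bij_betw_byWitness[where f' = "\<lambda>x. {v \<in> pverts G. x v = 1}"])
    show "\<forall>S\<in>{S. fixed_set G \<sigma> S}. {v \<in> pverts G. ind S v = 1} = S"
      by (auto simp: ind_def fixed_set_def)
    show "ind ` {S. fixed_set G \<sigma> S} \<subseteq> {x \<in> configurations G. conjunctive_network G \<sigma> x = x}"
      using ind_fixed by (auto simp: ind_def configurations_def fixed_set_def)
    show "(\<lambda>x. {v \<in> pverts G. x v = 1}) ` {x \<in> configurations G. conjunctive_network G \<sigma> x = x}
        \<subseteq> {S. fixed_set G \<sigma> S}"
    proof (intro subsetI, elim imageE)
      fix S x
      assume S: "S = {v \<in> pverts G. x v = 1}"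
        and x: "x \<in> {x \<in> configurations G. conjunctive_network G \<sigma> x = x}"
      then have "conjunctive_network G \<sigma> (ind S) = ind S" using ind_ones by simp
      then show "S \<in> {S. fixed_set G \<sigma> S}" using ind_fixed[of S] S by blast
    qed
  qed (use ind_ones in blast)
  from bij_betw_same_card[OF this] show ?thesis
    unfolding num_fixed_points_def by simp
qed

section \<open>Maximal independent sets as independent dominating sets\<close>

lemma maximal_independent_set_iff:
  "maximal_independent_set G S \<longleftrightarrow>
     independent_set G S \<and> (\<forall>v\<in>pverts G. v \<notin> S \<longrightarrow> (\<exists>u\<in>S. (u, v) \<in> parcs G))"
proof
  assume max: "maximal_independent_set G S"
  have "\<exists>u\<in>S. (u, v) \<in> parcs G" if "v \<in> pverts G" "v \<notin> S" for v
  proof (rule ccontr)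
    assume "\<not> (\<exists>u\<in>S. (u, v) \<in> parcs G)"
    then have "independent_set G (insert v S)"
      using max that arc_sym unfolding maximal_independent_set_def independent_set_def by auto
    then show False
      using max that unfolding maximal_independent_set_def by blast
  qed
  with max show "independent_set G S \<and> (\<forall>v\<in>pverts G. v \<notin> S \<longrightarrow> (\<exists>u\<in>S. (u, v) \<in> parcs G))"
    unfolding maximal_independent_set_def by blast
next
  assume "independent_set G S \<and> (\<forall>v\<in>pverts G. v \<notin> S \<longrightarrow> (\<exists>u\<in>S. (u, v) \<in> parcs G))"
  then show "maximal_independent_set G S"
    unfolding maximal_independent_set_def independent_set_def by blast
qed

lemma matched_maximal_empty: "matched_maximal G {} T \<longleftrightarrow> maximal_independent_set G T"
  by (auto simp: matched_maximal_def matched_independent_def maximal_independent_set_iff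
      independent_set_def)

lemma fixed_set_all_negative:
  assumes "\<And>e. e \<in> parcs G \<Longrightarrow> \<sigma> e = Negative"
  shows "fixed_set G \<sigma> S \<longleftrightarrow> maximal_independent_set G S"
proof -
  have "fixed_set G \<sigma> S \<longleftrightarrow>
      S \<subseteq> pverts G \<and> (\<forall>v\<in>pverts G. v \<in> S \<longleftrightarrow> (\<forall>u. (u, v) \<in> parcs G \<longrightarrow> u \<notin> S))"
    using assms by (auto simp: fixed_set_def)
  also have "\<dots> \<longleftrightarrow> maximal_independent_set G S"
    unfolding maximal_independent_set_iff independent_set_def by blast
  finally show ?thesis .
qed

section \<open>Maximal extension relative to a matching\<close>

lemma finite_matched_maximal: "finite {T. matched_maximal G M T}"
  by (rule finite_subset[of _ "Pow (pverts G)"])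
     (auto simp: matched_maximal_def matched_independent_def pair_finite_verts)

text \<open>An inclusion-maximal set among those adding only vertices outside
  \<open>Domain M\<close> works, since an undominated vertex outside \<open>Domain M\<close> could
  still be added. The last two conclusions control the new vertices, which later allows information
  about \<open>T\<close> to be read off \<open>T'\<close>.\<close>

lemma matched_independent_extend:
  assumes ind: "matched_independent G M T" and M: "M \<subseteq> parcs G" "sym M"
  obtains T' where "matched_maximal G M T'" "T \<subseteq> T'" "\<And>x. x \<in> T' - T \<Longrightarrow> x \<notin> Domain M"
    "\<And>x t. x \<in> T' - T \<Longrightarrow> t \<in> T \<Longrightarrow> (t, x) \<notin> parcs G"
proof -
  define C where "C = {X. matched_independent G M X \<and> T \<subseteq> X \<and> (X - T) \<inter> Domain M = {}}"
  have fin: "finite C"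
    by (rule finite_subset[of _ "Pow (pverts G)"])
       (auto simp: C_def matched_independent_def pair_finite_verts)
  have "C \<noteq> {}" using ind unfolding C_def by blast
  from finite_has_maximal[OF fin this]
  obtain X where X: "X \<in> C" and max: "\<And>Y. Y \<in> C \<Longrightarrow> X \<subseteq> Y \<Longrightarrow> X = Y"
    by blast
  have "\<exists>u\<in>X. (u, v) \<in> parcs G" if v: "v \<in> pverts G" "v \<notin> X" "v \<notin> Domain M" for v
  proof (rule ccontr)
    assume "\<not> (\<exists>u\<in>X. (u, v) \<in> parcs G)"
    then have free: "(u, v) \<notin> parcs G" "(v, u) \<notin> parcs G" if "u \<in> insert v X" for u
      using that arc_sym[of u v] by auto
    have "(v, b) \<notin> M" for b using v(3) by blast
    then have "matched_independent G M (insert v X)"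
      using X v(1) free unfolding C_def matched_independent_def by blast
    then have "insert v X \<in> C"
      using X v(3) unfolding C_def by blast
    with max v(2) show False by blast
  qed
  then have "matched_maximal G M X"
    using X unfolding C_def matched_maximal_def by blast
  moreover have "(t, x) \<notin> parcs G" if "x \<in> X - T" "t \<in> T" for x t
    using X that M(2) unfolding C_def matched_independent_def by (blast dest: symD)
  ultimately show thesis
    using that X unfolding C_def by blast
qed

section \<open>From fixed points to a matching\<close>

lemma card_fixed_sets_le_matched_maximal:
  obtains M where "matching G M" "card {S. fixed_set G \<sigma> S} \<le> card {T. matched_maximal G M T}"
proof -
  define P where "P = {(u, v) \<in> parcs G. \<sigma> (u, v) = Positive \<and> \<sigma> (v, u) = Positive}"
  \<comment> \<open>no fixed point contains a vertex of \<open>Z\<close>\<close>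
  define Z where "Z = {v. \<exists>u. (u, v) \<in> parcs G \<and> \<sigma> (u, v) = Positive \<and> \<sigma> (v, u) = Negative}"
  \<comment> \<open>The choice depends only on the set of vertices reachable in \<open>P\<close>, so
    it picks one representative per component; \<open>M\<close> then has one edge per nontrivial
    component, from the representative to a chosen neighbour.\<close>
  define rep where "rep v = (SOME x. (v, x) \<in> P\<^sup>*)" for v
  define mate where "mate a = (SOME b. (a, b) \<in> P)" for a
  define M where "M = (\<Union>a \<in> rep ` Domain P. {(a, mate a), (mate a, a)})"
  have sym_P: "sym P"
    using arc_sym by (auto simp: P_def sym_def)
  have P_arcs: "P \<subseteq> parcs G" by (auto simp: P_def)
  have rep: "(v, rep v) \<in> P\<^sup>*" for v
    unfolding rep_def by (rule someI[of _ v]) simp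
  have rep_eq: "rep v = rep w" if "(v, w) \<in> P\<^sup>*" for v w
  proof -
    have "(w, v) \<in> P\<^sup>*" using that sym_P by (meson sym_rtrancl symD)
    then have "(v, x) \<in> P\<^sup>* \<longleftrightarrow> (w, x) \<in> P\<^sup>*" for x
      using that by (meson rtrancl_trans)
    then show ?thesis by (simp add: rep_def)
  qed
  have rep_idem: "rep (rep v) = rep v" for v
    using rep_eq[OF rep] by simp
  have mate: "(a, mate a) \<in> P" if "a \<in> rep ` Domain P" for a
  proof -
    from that obtain v w where a: "a = rep v" and vw: "(v, w) \<in> P" by blast
    \<comment> \<open>A path from \<open>a\<close> to \<open>v\<close> either starts with an edge at
      \<open>a\<close> or is trivial, in which case \<open>vw\<close> itself is such an
      edge.\<close>
    have "(a, v) \<in> P\<^sup>*" using rep[of v] sym_P a by (meson sym_rtrancl symD)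
    then have "\<exists>b. (a, b) \<in> P"
      by (cases rule: converse_rtranclE) (use vw in auto)
    then show ?thesis unfolding mate_def by (rule someI_ex)
  qed
  have rep_mate: "rep (mate a) = a" "mate a \<noteq> a" if "a \<in> rep ` Domain P" for a
    using rep_eq[OF r_into_rtrancl[OF mate[OF that]]] rep_idem that mate[OF that] P_arcs by auto
  have M_P: "M \<subseteq> P"
    using mate sym_P by (auto simp: M_def dest: symD)
  have "sym M" by (auto simp: M_def sym_def)
  moreover have "single_valued M"
  proof (rule single_valuedI)
    fix x y z
    assume "(x, y) \<in> M" "(x, z) \<in> M"
    then obtain a b where ab: "a \<in> rep ` Domain P" "b \<in> rep ` Domain P"
      and y: "(x, y) = (a, mate a) \<or> (x, y) = (mate a, a)"
      and z: "(x, z) = (b, mate b) \<or> (x, z) = (mate b, b)"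
      unfolding M_def by blast
    have "rep a = a" "rep b = b" using ab rep_idem by auto
    with y z have "rep x = a" "rep x = b"
      using rep_mate(1)[OF ab(1)] rep_mate(1)[OF ab(2)] by (metis prod.inject)+
    with y z show "y = z" using rep_mate(2)[OF ab(1)] by (metis prod.inject)
  qed
  ultimately have M: "matching G M"
    using M_P P_arcs unfolding matching_def by blast
  have P_const: "v \<in> S \<Longrightarrow> w \<in> S" if "fixed_set G \<sigma> S" "(v, w) \<in> P\<^sup>*" for S v w
    using that(2)
  proof (induction rule: rtrancl_induct)
    case (step y z)
    then show ?case
      using that(1) in_arcsD1 in_arcsD2 arc_sym unfolding fixed_set_def P_def by blast
  qed
  have P_rep: "v \<in> S \<longleftrightarrow> rep v \<in> S" if "fixed_set G \<sigma> S" for S v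
    using P_const[OF that] rep[of v] sym_P by (meson sym_rtrancl symD)
  have inner: "(u, v) \<in> P" if "fixed_set G \<sigma> S" "u \<in> S" "v \<in> S" "(u, v) \<in> parcs G" for S u v
    using that arc_sym in_arcsD1 in_arcsD2 unfolding fixed_set_def P_def by blast
  \<comment> \<open>If \<open>v\<close> were in \<open>S\<close>, the positive arc \<open>uv\<close>
    would put \<open>u\<close> in \<open>S\<close>, and then the negative arc \<open>vu\<close>
    would exclude \<open>v\<close>.\<close>
  have no_Z: "S \<inter> Z = {}" if "fixed_set G \<sigma> S" for S
    using that arc_sym in_arcsD1 in_arcsD2 unfolding fixed_set_def Z_def
    by (smt (verit) disjoint_iff mem_Collect_eq sign.distinct(1))
  \<comment> \<open>Some arc into \<open>v\<close> forces the value 0. If it is negative, its tail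
    lies in \<open>S\<close>; if positive, the sign of the reverse arc decides between
    \<open>Z\<close> and \<open>Domain P\<close>.\<close>
  have outer: "v \<in> Z \<or> v \<in> Domain P \<or> (\<exists>u\<in>S. (u, v) \<in> parcs G)"
    if "fixed_set G \<sigma> S" "v \<in> pverts G" "v \<notin> S" for S v
  proof -
    from that obtain u where u: "(u, v) \<in> parcs G" "\<not> (\<sigma> (u, v) = Positive \<longleftrightarrow> u \<in> S)"
      unfolding fixed_set_def by blast
    show ?thesis
    proof (cases "u \<in> S")
      case False
      with u have "\<sigma> (u, v) = Positive" by blast
      moreover have "(v, u) \<in> parcs G" using u arc_sym by blast
      ultimately show ?thesis
        using u(1) unfolding Z_def P_def by (cases "\<sigma> (v, u)") auto
    qed (use u in blast)
  qed
  \<comment> \<open>\<open>S\<close> is recovered from \<open>T\<close>: the trace on \<open>Domain M\<close> determines it on \<open>Domain P\<close>\<close>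
  define r where "r S T \<longleftrightarrow> fixed_set G \<sigma> S \<and>
      S \<inter> Domain M = T \<inter> Domain M \<and>
      S - Domain P = T - Domain P - Z - {x. \<exists>s\<in>S \<inter> Domain P. (s, x) \<in> parcs G}" for S T
  have "\<exists>T\<in>{T. matched_maximal G M T}. r S T" if S: "fixed_set G \<sigma> S" for S
  proof -
    \<comment> \<open>From each nontrivial component of \<open>P\<close> only the ends of its chosen
      edge are kept. Adjacent vertices of \<open>S\<close> share a component, so the only edges left
      inside \<open>?T\<close> are those of \<open>M\<close>.\<close>
    let ?T = "(S - Domain P) \<union> (S \<inter> Domain M)"
    have "matched_independent G M ?T"
      unfolding matched_independent_def
    proof (intro conjI allI ballI impI)
      show "?T \<subseteq> pverts G" using S by (auto simp: fixed_set_def)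
    next
      fix a b assume ab: "(a, b) \<in> M" "a \<in> ?T"
      then have "a \<in> S" by blast
      with ab have "b \<in> S" using P_const[OF S] M_P by blast
      moreover have "b \<in> Domain M" using ab \<open>sym M\<close> by (blast dest: symD)
      ultimately show "b \<in> ?T" by blast
    next
      fix u v assume uv: "u \<in> ?T" "v \<in> ?T" "(u, v) \<in> parcs G"
      then have "(u, v) \<in> P" using inner[OF S] by blast
      moreover from this have "(v, u) \<in> P" using sym_P by (blast dest: symD)
      ultimately have D: "u \<in> Domain M" "v \<in> Domain M" using uv by blast+
      have "rep u = rep v" using rep_eq \<open>(u, v) \<in> P\<close> by blast
      moreover have "rep x \<in> rep ` Domain P \<and> (x = rep x \<or> x = mate (rep x))"
        if "x \<in> Domain M" for x
      proof -
        from that obtain a where a: "a \<in> rep ` Domain P" "x = a \<or> x = mate a"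
          unfolding M_def by blast
        moreover have "rep a = a" using a(1) rep_idem by blast
        ultimately show ?thesis using rep_mate(1)[OF a(1)] by metis
      qed
      moreover have "u \<noteq> v" using uv(3) by auto
      ultimately have "(u, v) = (rep u, mate (rep u)) \<or> (u, v) = (mate (rep u), rep u)"
        and "rep u \<in> rep ` Domain P"
        using D by metis+
      then show "(u, v) \<in> M"
        unfolding M_def by blast
    qed
    then obtain T where T: "matched_maximal G M T" "?T \<subseteq> T"
      "\<And>x. x \<in> T - ?T \<Longrightarrow> x \<notin> Domain M"
      "\<And>x t. x \<in> T - ?T \<Longrightarrow> t \<in> ?T \<Longrightarrow> (t, x) \<notin> parcs G"
      using matched_independent_extend M unfolding matching_def by metis
    have "S \<inter> Domain M = T \<inter> Domain M"
      using T(2,3) by blast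
    moreover have "S - Domain P = T - Domain P - Z - {x. \<exists>s\<in>S \<inter> Domain P. (s, x) \<in> parcs G}"
    proof (intro equalityI subsetI)
      fix x assume x: "x \<in> S - Domain P"
      then have "x \<notin> Z" using no_Z[OF S] by blast
      moreover have "(s, x) \<notin> parcs G" if "s \<in> S" for s
        using inner[OF S that] x sym_P by (blast dest: symD)
      ultimately show "x \<in> T - Domain P - Z - {x. \<exists>s\<in>S \<inter> Domain P. (s, x) \<in> parcs G}"
        using x T(2) by blast
    next
      fix x assume x: "x \<in> T - Domain P - Z - {x. \<exists>s\<in>S \<inter> Domain P. (s, x) \<in> parcs G}"
      show "x \<in> S - Domain P"
      proof (rule ccontr)
        assume "x \<notin> S - Domain P"
        with x have "x \<notin> S" "x \<notin> ?T" by blast+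
        moreover have "x \<in> pverts G"
          using x T(1) unfolding matched_maximal_def matched_independent_def by blast
        \<comment> \<open>Such a \<open>u\<close> cannot exist: in \<open>Domain P\<close> it is
          ruled out by the subtracted neighbours, and outside it lies in \<open>?T\<close>, to which
          a new vertex is not adjacent.\<close>
        ultimately obtain u where "u \<in> S" "(u, x) \<in> parcs G"
          using outer[OF S] x by blast
        with x T(4)[of x u] \<open>x \<notin> ?T\<close> show False by blast
      qed
    qed
    ultimately show ?thesis
      using S T(1) unfolding r_def by blast
  qed
  moreover have "S1 = S2" if "r S1 T" "r S2 T" for S1 S2 T
  proof -
    have fixed: "fixed_set G \<sigma> S1" "fixed_set G \<sigma> S2" and MM: "S1 \<inter> Domain M = S2 \<inter> Domain M"
      using that unfolding r_def by blast+
    have "x \<in> S1 \<longleftrightarrow> x \<in> S2" if "x \<in> Domain P" for x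
    proof -
      have "rep x \<in> Domain M" using that unfolding M_def by blast
      then show ?thesis using P_rep[OF fixed(1)] P_rep[OF fixed(2)] MM by blast
    qed
    then have "S1 \<inter> Domain P = S2 \<inter> Domain P" by blast
    moreover from this have "S1 - Domain P = S2 - Domain P"
      using that unfolding r_def by auto
    ultimately show ?thesis by blast
  qed
  ultimately have "card {S. fixed_set G \<sigma> S} \<le> card {T. matched_maximal G M T}"
    by (intro card_le_if_inj_on_rel[where r = r] finite_matched_maximal) blast+
  with M show thesis using that by blast
qed

section \<open>Releasing one edge of the matching\<close>

lemma induced_C4I:
  assumes arcs: "(a, u) \<in> parcs G" "(u, v) \<in> parcs G" "(v, b) \<in> parcs G" "(b, a) \<in> parcs G"
    and nonarcs: "(a, v) \<notin> parcs G" "(u, b) \<notin> parcs G"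
    and neq: "a \<noteq> v" "u \<noteq> b"
  shows "has_induced_C4 G"
proof -
  have dist: "distinct [a, u, v, b]"
    using arcs neq by auto
  have rev: "(u, a) \<in> parcs G" "(v, u) \<in> parcs G" "(b, v) \<in> parcs G" "(a, b) \<in> parcs G"
    "(v, a) \<notin> parcs G" "(b, u) \<notin> parcs G"
    using arcs nonarcs arc_sym by blast+
  define h :: "nat \<Rightarrow> 'a" where "h i = [a, u, v, b] ! i" for i
  have h: "h 0 = a" "h 1 = u" "h (Suc 0) = u" "h 2 = v" "h 3 = b"
    by (auto simp: h_def)
  define H where "H = \<lparr>pverts = {a, u, v, b},
    parcs = {(a, u), (u, a), (u, v), (v, u), (v, b), (b, v), (b, a), (a, b)}\<rparr>"
  define f where "f = \<lparr>iso_verts = h, iso_arcs = map_prod h h,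
    iso_head = snd, iso_tail = fst\<rparr>"
  have inj: "inj_on h {0, 1, 2, 3}"
    using dist by (auto simp: h)
  have "inj_on (map_prod h h) ({0, 1, 2, 3} \<times> {0, 1, 2, 3})"
    by (rule map_prod_inj_on[OF inj inj])
  then have inj_arcs: "inj_on (map_prod h h) (parcs C4)"
    by (rule inj_on_subset) (auto simp: C4_def)
  have C4_wf: "pair_wf_digraph C4"
    using pair_graph_C4 by (simp add: pair_graph.axioms pair_graph_def pair_digraph_def
        pair_fin_digraph_def)
  then have "pre_digraph.digraph_isomorphism (with_proj C4) f"
    using inj inj_arcs unfolding pre_digraph.digraph_isomorphism_def
    by (auto simp: f_def C4_def wf_digraph_wp_iff)
  moreover have "with_proj H = app_iso f (with_proj C4)"
    by (auto simp: app_iso_def with_proj_def f_def H_def C4_def h)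
  ultimately have iso: "digraph_iso (with_proj C4) (with_proj H)"
    unfolding digraph_iso_def by blast
  have "pair_wf_digraph H"
    by unfold_locales (auto simp: H_def)
  moreover have "pverts H \<subseteq> pverts G"
    using arcs in_arcsD1 by (auto simp: H_def)
  moreover have "parcs H = {e \<in> parcs G. fst e \<in> pverts H \<and> snd e \<in> pverts H}"
  proof -
    \<comment> \<open>The subgraph is induced because the two diagonals are non-arcs and
      \<open>G\<close> has no loops.\<close>
    have "(p, q) \<in> parcs G \<longleftrightarrow> (p, q) \<in> parcs H"
      if "p \<in> {a, u, v, b}" "q \<in> {a, u, v, b}" for p q
      using that dist by (auto simp: H_def arcs rev nonarcs)
    moreover have "fst e \<in> {a, u, v, b} \<and> snd e \<in> {a, u, v, b}" if "e \<in> parcs H" for e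
      using that by (auto simp: H_def)
    moreover have "pverts H = {a, u, v, b}" by (simp add: H_def)
    ultimately show ?thesis by (metis (no_types, lifting) Collect_cong Collect_mem_eq prod.collapse)
  qed
  moreover have "pair_wf_digraph G" ..
  ultimately have "induced_subgraph (with_proj H) (with_proj G)"
    unfolding induced_subgraph_def subgraph_def compatible_def
    by (auto simp: wf_digraph_wp_iff)
  with iso show ?thesis
    unfolding has_induced_C4_def by blast
qed

text \<open>A relation \<open>r\<close> links each set for \<open>M\<close> to some set for the
  smaller matching, and no set for the smaller matching to two sets for \<open>M\<close>. The
  absence of an induced 4-cycle enters only in \<open>kept_free\<close>, which separates the images
  of sets containing \<open>u\<close> and \<open>v\<close> from those of sets avoiding both.\<close>

lemma card_matched_maximal_le_remove_edge:
  assumes C4: "\<not> has_induced_C4 G" and M: "matching G M" and uv: "(u, v) \<in> M"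
  shows "card {T. matched_maximal G M T} \<le> card {T. matched_maximal G (M - {(u, v), (v, u)}) T}"
proof -
  define M' where "M' = M - {(u, v), (v, u)}"
  have arcs: "M \<subseteq> parcs G" and "sym M" and sv: "single_valued M"
    using M by (auto simp: matching_def)
  have M'_arcs: "M' \<subseteq> parcs G" and "sym M'"
    using arcs \<open>sym M\<close> by (auto simp: M'_def sym_def)
  have vu: "(v, u) \<in> M" using uv \<open>sym M\<close> by (blast dest: symD)
  have uv_arc: "(u, v) \<in> parcs G" "(v, u) \<in> parcs G" using uv vu arcs by blast+
  have u_M: "(u, x) \<in> M \<longleftrightarrow> x = v" "(x, u) \<in> M \<longleftrightarrow> x = v"
    and v_M: "(v, x) \<in> M \<longleftrightarrow> x = u" "(x, v) \<in> M \<longleftrightarrow> x = u" for x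
    using uv vu sv \<open>sym M\<close> by (auto dest: single_valuedD symD)
  have Dom: "Domain M' = Domain M - {u, v}"
    using u_M v_M by (auto simp: M'_def)
  have M'_away: "(a, b) \<in> M' \<longleftrightarrow> (a, b) \<in> M \<and> a \<notin> {u, v} \<and> b \<notin> {u, v}" for a b
    using u_M v_M unfolding M'_def by blast
  have M'_I: "(a, b) \<in> M'" if "(a, b) \<in> M" "a \<notin> {u, v}" for a b
    using u_M v_M that unfolding M'_def by blast
  have ne: "u \<noteq> v" using uv_arc by auto
  have verts: "u \<in> pverts G" "v \<in> pverts G" using uv_arc in_arcsD1 by blast+
  \<comment> \<open>If \<open>T\<close> contains \<open>u\<close> and \<open>v\<close>, keep \<open>u\<close> when some free vertex would be dominated by \<open>u\<close> only,
    and \<open>v\<close> otherwise; if \<open>T\<close> avoids both, add \<open>u\<close> in preference to \<open>v\<close>. The opposite preferences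
    keep the two images disjoint.\<close>
  define X where "X T = {x \<in> pverts G - Domain M. (x, u) \<in> parcs G \<and> (x, v) \<notin> parcs G \<and>
      (\<forall>t\<in>T - {u, v}. (t, x) \<notin> parcs G)}" for T
  define kept where "kept T T' \<longleftrightarrow> u \<in> T \<and> v \<in> T \<and> T - {u, v} \<subseteq> T' \<and>
      T' - T - {u, v} \<subseteq> {x. (u, x) \<in> parcs G \<or> (v, x) \<in> parcs G} \<and>
      (X T \<noteq> {} \<and> u \<in> T' \<or> X T = {} \<and> T' = insert v (T - {u, v}))" for T T'
  define free where "free T T' \<longleftrightarrow> u \<notin> T \<and> v \<notin> T \<and> T' - {u, v} = T \<and>
      (v \<in> T' \<longrightarrow> (\<exists>t\<in>T. (t, u) \<in> parcs G))" for T T'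
  define r where "r T T' \<longleftrightarrow> matched_maximal G M T \<and> matched_maximal G M' T' \<and>
      (kept T T' \<or> free T T')" for T T'
  have both: "u \<in> T \<longleftrightarrow> v \<in> T" if "matched_maximal G M T" for T
    using that uv vu unfolding matched_maximal_def matched_independent_def by blast
  have separated: "(t, u) \<notin> parcs G" "(t, v) \<notin> parcs G"
    if "matched_maximal G M T" "u \<in> T" "t \<in> T - {u, v}" for T t
  proof -
    have "v \<in> T" using both that by blast
    have "(p, q) \<in> M" if "p \<in> T" "q \<in> T" "(p, q) \<in> parcs G" for p q
      using \<open>matched_maximal G M T\<close> that unfolding matched_maximal_def matched_independent_def by blast
    from this[of t u] this[of t v] show "(t, u) \<notin> parcs G" "(t, v) \<notin> parcs G"
      using that \<open>v \<in> T\<close> u_M v_M by blast+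
  qed
  have ex_kept: "\<exists>T'. matched_maximal G M' T' \<and> kept T T'"
    if T: "matched_maximal G M T" and "u \<in> T" for T
  proof -
    have "v \<in> T" using both that by blast
    have T_ind: "T \<subseteq> pverts G" "\<And>a b. (a, b) \<in> M \<Longrightarrow> a \<in> T \<Longrightarrow> b \<in> T"
      "\<And>a b. a \<in> T \<Longrightarrow> b \<in> T \<Longrightarrow> (a, b) \<in> parcs G \<Longrightarrow> (a, b) \<in> M"
      and T_max: "\<And>x. x \<in> pverts G \<Longrightarrow> x \<notin> T \<Longrightarrow> x \<notin> Domain M \<Longrightarrow> \<exists>t\<in>T. (t, x) \<in> parcs G"
      using T unfolding matched_maximal_def matched_independent_def by blast+
    define w where "w = (if X T = {} then v else u)"
    have w: "w \<in> {u, v}" by (simp add: w_def)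
    have "matched_independent G M' (insert w (T - {u, v}))"
      unfolding matched_independent_def
    proof (intro conjI allI ballI impI)
      show "insert w (T - {u, v}) \<subseteq> pverts G" using T_ind(1) verts by (auto simp: w_def)
    next
      fix a b assume "(a, b) \<in> M'" "a \<in> insert w (T - {u, v})"
      then have "(a, b) \<in> M" "a \<in> T" "b \<notin> {u, v}"
        unfolding M'_away w_def by (auto split: if_splits)
      then show "b \<in> insert w (T - {u, v})" using T_ind(2) by blast
    next
      fix p q assume pq: "p \<in> insert w (T - {u, v})" "q \<in> insert w (T - {u, v})" "(p, q) \<in> parcs G"
      have "(t, w) \<notin> parcs G" "(w, t) \<notin> parcs G" if "t \<in> T - {u, v}" for t
        using separated[OF T \<open>u \<in> T\<close> that] arc_sym[of t] by (auto simp: w_def)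
      then have "p \<in> T - {u, v}" "q \<in> T - {u, v}" using pq arc_irrefl by blast+
      then show "(p, q) \<in> M'" using T_ind(3) pq(3) M'_I by blast
    qed
    then obtain T' where T': "matched_maximal G M' T'" "insert w (T - {u, v}) \<subseteq> T'"
      "\<And>x. x \<in> T' - insert w (T - {u, v}) \<Longrightarrow> x \<notin> Domain M'"
      "\<And>x t. x \<in> T' - insert w (T - {u, v}) \<Longrightarrow> t \<in> insert w (T - {u, v}) \<Longrightarrow> (t, x) \<notin> parcs G"
      using matched_independent_extend M'_arcs \<open>sym M'\<close> by metis
    \<comment> \<open>Such an \<open>x\<close> was dominated by \<open>T\<close>, but the extension
      adds no neighbour of a surviving vertex, so its neighbours in \<open>T\<close> are among
      \<open>u\<close> and \<open>v\<close>.\<close>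
    have new: "x \<in> pverts G \<and> x \<notin> Domain M \<and> ((u, x) \<in> parcs G \<or> (v, x) \<in> parcs G)"
      if x: "x \<in> T' - T - {u, v}" for x
    proof -
      have "x \<in> pverts G"
        using x T'(1) unfolding matched_maximal_def matched_independent_def by blast
      moreover have "x \<notin> Domain M"
        using x T'(3)[of x] Dom by (auto simp: w_def)
      ultimately obtain t where "t \<in> T" "(t, x) \<in> parcs G"
        using T_max[of x] x by blast
      moreover have "t \<in> {u, v}"
        using T'(4)[of x t] x calculation w by blast
      ultimately show ?thesis
        using \<open>x \<in> pverts G\<close> \<open>x \<notin> Domain M\<close> by blast
    qed
    \<comment> \<open>Here \<open>v\<close> is kept, so an added vertex is adjacent to
      \<open>u\<close> but not to \<open>v\<close> and has no other neighbour in \<open>T\<close>: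
      it would lie in \<open>X T\<close>.\<close>
    have "T' = insert v (T - {u, v})" if empty: "X T = {}"
    proof (rule ccontr)
      assume "T' \<noteq> insert v (T - {u, v})"
      then obtain x where x: "x \<in> T'" "x \<notin> insert v (T - {u, v})"
        using T'(2) empty by (auto simp: w_def)
      then have "(v, x) \<notin> parcs G" using T'(4)[of x v] empty by (auto simp: w_def)
      with uv_arc x have "x \<in> T' - T - {u, v}" by auto
      moreover have "\<forall>t\<in>T - {u, v}. (t, x) \<notin> parcs G"
        using T'(4)[of x] x empty by (auto simp: w_def)
      ultimately have "x \<in> X T"
        using new[of x] \<open>(v, x) \<notin> parcs G\<close> arc_sym unfolding X_def by blast
      with empty show False by blast
    qed
    moreover have "u \<in> T'" if "X T \<noteq> {}"
      using T'(2) that by (simp add: w_def)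
    ultimately have "kept T T'"
      using \<open>u \<in> T\<close> \<open>v \<in> T\<close> T'(2) new unfolding kept_def by blast
    with T'(1) show ?thesis by blast
  qed
  have ex_free: "\<exists>T'. matched_maximal G M' T' \<and> free T T'"
    if T: "matched_maximal G M T" and "u \<notin> T" for T
  proof -
    have "v \<notin> T" using both that by blast
    have T_ind: "T \<subseteq> pverts G" "\<And>a b. (a, b) \<in> M \<Longrightarrow> a \<in> T \<Longrightarrow> b \<in> T"
      "\<And>a b. a \<in> T \<Longrightarrow> b \<in> T \<Longrightarrow> (a, b) \<in> parcs G \<Longrightarrow> (a, b) \<in> M"
      and T_max: "\<And>x. x \<in> pverts G \<Longrightarrow> x \<notin> T \<Longrightarrow> x \<notin> Domain M \<Longrightarrow> \<exists>t\<in>T. (t, x) \<in> parcs G"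
      using T unfolding matched_maximal_def matched_independent_def by blast+
    define T1 where "T1 = (if \<exists>t\<in>T. (t, u) \<in> parcs G then T else insert u T)"
    have "matched_independent G M' T1"
      unfolding matched_independent_def
    proof (intro conjI allI ballI impI)
      show "T1 \<subseteq> pverts G" using T_ind(1) verts by (auto simp: T1_def)
    next
      fix a b assume "(a, b) \<in> M'" "a \<in> T1"
      then have "(a, b) \<in> M" "a \<in> T"
        unfolding M'_away T1_def by (auto split: if_splits)
      then show "b \<in> T1" using T_ind(2) by (auto simp: T1_def)
    next
      fix p q assume pq: "p \<in> T1" "q \<in> T1" "(p, q) \<in> parcs G"
      have "(t, u) \<notin> parcs G" "(u, t) \<notin> parcs G" if "t \<in> T" "u \<in> T1" for t
        using that \<open>u \<notin> T\<close> arc_sym[of t] by (auto simp: T1_def split: if_splits)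
      moreover have "x = u \<or> x \<in> T" if "x \<in> T1" for x
        using that by (auto simp: T1_def split: if_splits)
      ultimately have "p \<in> T" "q \<in> T" using pq arc_irrefl by metis+
      then show "(p, q) \<in> M'" using T_ind(3) pq(3) M'_I \<open>u \<notin> T\<close> \<open>v \<notin> T\<close> by blast
    qed
    then obtain T' where T': "matched_maximal G M' T'" "T1 \<subseteq> T'"
      "\<And>x. x \<in> T' - T1 \<Longrightarrow> x \<notin> Domain M'"
      "\<And>x t. x \<in> T' - T1 \<Longrightarrow> t \<in> T1 \<Longrightarrow> (t, x) \<notin> parcs G"
      using matched_independent_extend M'_arcs \<open>sym M'\<close> by metis
    \<comment> \<open>Apart from \<open>u\<close> and \<open>v\<close>, every vertex eligible for
      addition is already dominated by \<open>T\<close>.\<close>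
    have "x \<in> {u, v}" if x: "x \<in> T' - T" for x
    proof (rule ccontr)
      assume "x \<notin> {u, v}"
      then have "x \<in> T' - T1" using x by (auto simp: T1_def split: if_splits)
      moreover from this have "x \<notin> Domain M" using T'(3) Dom \<open>x \<notin> {u, v}\<close> by blast
      moreover have "x \<in> pverts G"
        using x T'(1) unfolding matched_maximal_def matched_independent_def by blast
      ultimately show False
        using T_max[of x] T'(4)[of x] x by (auto simp: T1_def split: if_splits)
    qed
    moreover have "\<exists>t\<in>T. (t, u) \<in> parcs G" if "v \<in> T'"
    proof (rule ccontr)
      assume "\<not> (\<exists>t\<in>T. (t, u) \<in> parcs G)"
      then have "T1 = insert u T" by (auto simp: T1_def)
      then show False
        using T'(4)[of v u] that uv_arc ne \<open>v \<notin> T\<close> by blast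
    qed
    moreover have "T \<subseteq> T'" using T'(2) by (auto simp: T1_def split: if_splits)
    ultimately have "free T T'"
      using \<open>u \<notin> T\<close> \<open>v \<notin> T\<close> unfolding free_def by blast
    with T'(1) show ?thesis by blast
  qed
  have kept_free: False
    if T: "matched_maximal G M T" "kept T Y" and S: "matched_maximal G M S" "free S Y"
      and Y: "matched_maximal G M' Y" for T S Y
  proof (cases "X T = {}")
    case True
    then have "Y = insert v (T - {u, v})" using T(2) by (auto simp: kept_def)
    \<comment> \<open>Since \<open>v\<close> is in \<open>Y\<close>, \<open>free\<close> gives
      \<open>u\<close> a neighbour in \<open>S\<close>, against \<open>separated\<close>.\<close>
    then have "S = T - {u, v}" "v \<in> Y" using S(2) by (auto simp: free_def)
    then show False
      using S(2) T separated(1)[OF T(1)] by (auto simp: free_def kept_def)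
  next
    case False
    then obtain x where x: "x \<in> X T" by blast
    have "u \<in> Y" "u \<in> T" using False T(2) by (auto simp: kept_def)
    have S_Y: "S = Y - {u, v}" using S(2) by (auto simp: free_def)
    have Y_ind: "(p, q) \<in> M'" if "p \<in> Y" "q \<in> Y" "(p, q) \<in> parcs G" for p q
      using that Y unfolding matched_maximal_def matched_independent_def by blast
    have x_Y: "x \<notin> Y"
      using Y_ind[of x u] \<open>u \<in> Y\<close> x Dom by (auto simp: X_def)
    \<comment> \<open>The vertex \<open>x\<close> sees \<open>u\<close> but not \<open>v\<close>.
      Its dominator \<open>y\<close> in \<open>S\<close> is new relative to \<open>T\<close>, hence
      adjacent to \<open>u\<close> or \<open>v\<close>, and not to \<open>u\<close> because both lie
      in \<open>Y\<close>. Thus \<open>x\<close>, \<open>u\<close>, \<open>v\<close>,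
      \<open>y\<close> form an induced 4-cycle.\<close>
    then have "\<exists>y\<in>S. (y, x) \<in> parcs G"
      using S(1) x unfolding S_Y matched_maximal_def X_def by blast
    then obtain y where y: "y \<in> S" "(y, x) \<in> parcs G" by blast
    then have "y \<notin> T" using x S_Y by (auto simp: X_def)
    with y S_Y T(2) have "(u, y) \<in> parcs G \<or> (v, y) \<in> parcs G"
      by (auto simp: kept_def)
    moreover have "(u, y) \<notin> parcs G"
      using Y_ind[of u y] y S_Y \<open>u \<in> Y\<close> u_M by (auto simp: M'_def)
    ultimately have "has_induced_C4 G"
      using induced_C4I[of x u v y] x y uv_arc vu S_Y by (auto simp: X_def)
    with C4 show False by blast
  qed
  have inj: "T = S" if "r T Y" "r S Y" for T S Y
  proof -
    have max: "matched_maximal G M T" "matched_maximal G M S" "matched_maximal G M' Y"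
      using that by (auto simp: r_def)
    \<comment> \<open>Vertices of \<open>Q\<close> other than \<open>u\<close> and \<open>v\<close>
      are adjacent to neither, whereas every vertex added to form \<open>Y\<close>, apart from
      \<open>u\<close> and \<open>v\<close>, is adjacent to one of them; so \<open>Y\<close>
      determines \<open>Q\<close>.\<close>
    have kept_eq: "Q = (Y - {x. (u, x) \<in> parcs G \<or> (v, x) \<in> parcs G}) \<union> {u, v}"
      if "matched_maximal G M Q" "kept Q Y" for Q
    proof -
      have "(u, x) \<notin> parcs G" "(v, x) \<notin> parcs G" if "x \<in> Q - {u, v}" for x
        using separated[OF \<open>matched_maximal G M Q\<close> _ that] arc_sym[of x] \<open>kept Q Y\<close>
        unfolding kept_def by blast+
      then show ?thesis
        using \<open>kept Q Y\<close> uv_arc unfolding kept_def by blast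
    qed
    show ?thesis
    proof (cases "kept T Y")
      case True
      then have "kept S Y" using that(2) kept_free max unfolding r_def by blast
      with True show ?thesis using kept_eq[OF max(1)] kept_eq[OF max(2)] by blast
    next
      case False
      then have "free T Y" using that(1) unfolding r_def by blast
      moreover have "free S Y"
        using that(2) kept_free[OF max(2) _ max(1) calculation max(3)] unfolding r_def by blast
      ultimately show ?thesis unfolding free_def by blast
    qed
  qed
  have "\<exists>T'\<in>{T. matched_maximal G M' T}. r T T'" if "T \<in> {T. matched_maximal G M T}" for T
    using that ex_kept ex_free unfolding r_def by blast
  with inj show ?thesis
    unfolding M'_def[symmetric]
    by (intro card_le_if_inj_on_rel[where r = r] finite_matched_maximal) blast+
qed

section \<open>The upper bound and its attainment\<close>

lemma card_matched_maximal_le_mis: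
  assumes C4: "\<not> has_induced_C4 G" and M: "matching G M"
  shows "card {T. matched_maximal G M T} \<le> mis G"
proof -
  have "finite M"
    using M finite_subset[OF _ pair_finite_arcs] unfolding matching_def by blast
  then show ?thesis
    using M
  proof (induction M rule: finite_psubset_induct)
    case (psubset M)
    show ?case
    proof (cases "M = {}")
      case True
      then show ?thesis by (simp add: matched_maximal_empty mis_def)
    next
      case False
      then obtain u v where uv: "(u, v) \<in> M" by auto
      let ?M = "M - {(u, v), (v, u)}"
      have "matching G ?M"
        using psubset.prems by (auto simp: matching_def sym_def single_valued_def)
      with uv have "card {T. matched_maximal G ?M T} \<le> mis G"
        by (intro psubset.IH) auto
      with card_matched_maximal_le_remove_edge[OF C4 psubset.prems uv] show ?thesis
        by linarith
    qed
  qed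
qed

end

theorem corollary1:
  fixes G :: "'a pair_pre_digraph"
  assumes "pair_graph G"
    and "\<not> has_induced_C4 G"
  shows "Max (num_fixed_points G ` sign_repartitions G) = mis G"
proof -
  interpret pair_graph G by fact
  \<comment> \<open>The restriction to \<open>parcs G\<close> makes this sign function extensional,
    as membership in \<open>sign_repartitions\<close> demands.\<close>
  let ?neg = "\<lambda>e\<in>parcs G. Negative"
  have "num_fixed_points G \<sigma> \<le> mis G" for \<sigma>
  proof -
    obtain M where "matching G M" "card {S. fixed_set G \<sigma> S} \<le> card {T. matched_maximal G M T}"
      using card_fixed_sets_le_matched_maximal by blast
    then show ?thesis
      using card_matched_maximal_le_mis[OF assms(2), of M] by (simp add: num_fixed_points_eq)
  qed
  moreover have "num_fixed_points G ?neg = mis G"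
    by (simp add: num_fixed_points_eq fixed_set_all_negative mis_def)
  moreover have "?neg \<in> sign_repartitions G"
    by (auto simp: sign_repartitions_def)
  ultimately show ?thesis
    using finite_sign_repartitions by (intro Max_eqI) force+
qed

end
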